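(* Let $X$ be a real Banach space, let $\varepsilon>0$ be a real number, and let $\kappa,\lambda$ be infinite cardinals such that the partition relation $\kappa\to(\lambda,\aleph_0)^{<\omega}_2$ holds. Then each normalized weakly null sequence $\{x_\alpha\}_{\alpha<\kappa}\subset X$ contains a $(1+\varepsilon)$-suppression unconditional subsequence of length $\lambda$.
   Context: Notation: $[S]^n$ is the set of $n$-element subsets of $S$ and $[S]^{<\omega}$ is the set of finite subsets of $S$. For cardinals $\kappa,\lambda,\mu$, the relation $\kappa\to(\lambda,\mu)^{<\omega}_2$ means: for any coloring $c\colon[\kappa]^{<\omega}\to\{0,1\}$ there are $K_0,K_1\subset\kappa$ with $|K_0|=\lambda$, $|K_1|=\mu$ such that for each $0<n<\omega$ one has $c([K_0]^n)=\{0\}$ or $c([K_1]^n)=\{1\}$. A sequence $\{x_\alpha\}_{\alpha<\kappa}\subset X$ is weakly null if $\{f(x_\alpha)\}_{\alpha<\kappa}\in c_0(\kappa)$ for each $f\in X^*$, i.e. for all $f\in X^*$ and $\delta>0$ the set $\{\alpha<\kappa:|f(x_\alpha)|>\delta\}$ is finite. Normalized means $\|x_\alpha\|=1$ for all $\alpha$. A subsequence of length $\lambda$ is $\{x_{\alpha_\sigma}\}_{\sigma<\lambda}$ with $\sigma\mapsto\alpha_\sigma$ strictly increasing. A normalized sequence $\{e_\alpha\}_{\alpha<\lambda}$ is $C$-suppression unconditional ($C\ge1$) if $\|\sum_{\alpha\in A}c_\alpha e_\alpha\|\le C\|\sum_{\alpha\in B}c_\alpha e_\alpha\|$ for all finite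 $A\subset B\subset\lambda$ and all $c_\alpha\in\mathbb{R}$, $\alpha\in B$. *)

theory Defs
  imports "HOL-Analysis.Analysis" "HOL-Library.Ramsey"
begin

unbundle cardinal_syntax

text \<open>Cardinals are represented, as in the library, by cardinal orders \<^term>\<open>\<kappa> :: 'k rel\<close>, i.e. initial
  well-orders on \<^term>\<open>Field \<kappa>\<close>. Thus \<^term>\<open>Field \<kappa>\<close> plays the role of the set of ordinals below \<open>\<kappa>\<close>.\<close>

definition partition_arrow :: "'k rel \<Rightarrow> 'l rel \<Rightarrow> 'm rel \<Rightarrow> bool"
  where "partition_arrow \<kappa> \<theta> \<mu> \<longleftrightarrow>
    (\<forall>c :: 'k set \<Rightarrow> nat. c \<in> Fpow (Field \<kappa>) \<rightarrow> {0, 1} \<longrightarrow>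
      (\<exists>K\<^sub>0 K\<^sub>1. K\<^sub>0 \<subseteq> Field \<kappa> \<and> K\<^sub>1 \<subseteq> Field \<kappa> \<and> |K\<^sub>0| =o \<theta> \<and> |K\<^sub>1| =o \<mu> \<and>
        (\<forall>n>0. c ` nsets K\<^sub>0 n = {0} \<or> c ` nsets K\<^sub>1 n = {1})))"

definition normalized_on :: "'i set \<Rightarrow> ('i \<Rightarrow> 'a::real_normed_vector) \<Rightarrow> bool"
  where "normalized_on I x \<longleftrightarrow> (\<forall>i\<in>I. norm (x i) = 1)"

definition weakly_null_on :: "'i set \<Rightarrow> ('i \<Rightarrow> 'a::real_normed_vector) \<Rightarrow> bool"
  where "weakly_null_on I x \<longleftrightarrow>
    (\<forall>f :: 'a \<Rightarrow> real. bounded_linear f \<longrightarrow> (\<forall>\<delta>>0. finite {i \<in> I. \<bar>f (x i)\<bar> > \<delta>}))"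

definition suppression_unconditional_on ::
    "real \<Rightarrow> 'i set \<Rightarrow> ('i \<Rightarrow> 'a::real_normed_vector) \<Rightarrow> bool"
  where "suppression_unconditional_on C I e \<longleftrightarrow> C \<ge> 1 \<and> normalized_on I e \<and>
    (\<forall>A B. \<forall>c :: 'i \<Rightarrow> real. finite B \<and> A \<subseteq> B \<and> B \<subseteq> I \<longrightarrow>
      norm (\<Sum>i\<in>A. c i *\<^sub>R e i) \<le> C * norm (\<Sum>i\<in>B. c i *\<^sub>R e i))"

text \<open>The index maps of subsequences of length \<open>\<theta>\<close> of a sequence of length \<open>\<kappa>\<close>:\<close>

definition strictly_increasing_into :: "'l rel \<Rightarrow> 'k rel \<Rightarrow> ('l \<Rightarrow> 'k) \<Rightarrow> bool"
  where "strictly_increasing_into \<theta> \<kappa> \<alpha> \<longleftrightarrow> \<alpha> ` Field \<theta> \<subseteq> Field \<kappa> \<and>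
    monotone_on (Field \<theta>) (\<lambda>\<sigma> \<tau>. (\<sigma>, \<tau>) \<in> \<theta> \<and> \<sigma> \<noteq> \<tau>) (\<lambda>\<beta> \<gamma>. (\<beta>, \<gamma>) \<in> \<kappa> \<and> \<beta> \<noteq> \<gamma>) \<alpha>"

end

theory Submission
  imports Defs
begin

text \<open>
  Colour a finite set \<open>F\<close> of indices by 0 iff \<open>(x\<^sub>i)\<close>, \<open>i \<in> F\<close>, is \<open>(1 + \<epsilon>)\<close>-suppression unconditional.
  Since this property is tested on finite subsets, it is enough that for every \<open>n\<close> an infinite normalized weakly
  null sequence has an \<open>n\<close>-element subfamily of colour 0. If not, then after rounding coefficients and
  applying Ramsey's theorem there are an infinite \<open>Y\<close>, fixed coefficients and a fixed position \<open>p\<close> such that on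
  every \<open>n\<close>-subset of \<open>Y\<close> dropping the term at position \<open>p\<close> increases the norm by a fixed amount.
  Let that term vary over a block of \<open>Y\<close> and average: by Mazur's theorem some convex combination of the
  block is small in norm, and adding a small vector cannot decrease the norm by a fixed amount.
\<close>

section \<open>Sublinear functionals and the Hahn-Banach theorem\<close>

definition sublinear :: "('a::real_vector \<Rightarrow> real) \<Rightarrow> bool"
  where "sublinear p \<longleftrightarrow>
    (\<forall>u v. p (u + v) \<le> p u + p v) \<and> (\<forall>t\<ge>0. \<forall>v. p (t *\<^sub>R v) = t * p v)"

lemma sublinear_add: "sublinear p \<Longrightarrow> p (u + v) \<le> p u + p v"
  and sublinear_scale: "sublinear p \<Longrightarrow> t \<ge> 0 \<Longrightarrow> p (t *\<^sub>R v) = t * p v"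
  by (auto simp: sublinear_def)

lemma sublinear_zero: "sublinear p \<Longrightarrow> p 0 = 0"
  using sublinear_scale[of p 0 0] by simp

lemma sublinear_neg: "sublinear p \<Longrightarrow> - p (- v) \<le> p v"
  using sublinear_add[of p v "- v"] sublinear_zero[of p] by simp

text \<open>Supplies the lower bound of a chain for Zorn's lemma. Domination by \<open>p\<close>
  keeps the infimum finite, since \<open>- p (- v)\<close> bounds every \<open>q v\<close> from
  below. For subadditivity, two members of a chain have the smaller of them as a common minorant, so
  the infima in \<open>q u + r v\<close> may be taken independently.\<close>

lemma sublinear_INF_chain:
  fixes C :: "('a::real_vector \<Rightarrow> real) set"
  assumes "C \<noteq> {}" and sub: "\<And>q. q \<in> C \<Longrightarrow> sublinear q"
    and chain: "\<And>q r. q \<in> C \<Longrightarrow> r \<in> C \<Longrightarrow> q \<le> r \<or> r \<le> q"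
    and le: "\<And>q. q \<in> C \<Longrightarrow> q \<le> p"
  shows "sublinear (\<lambda>v. INF q\<in>C. q v)"
    and "r \<in> C \<Longrightarrow> (INF q\<in>C. q v) \<le> r v"
proof -
  have bdd: "bdd_below ((\<lambda>q. q v) ` C)" for v
  proof (rule bdd_belowI2)
    fix q assume q: "q \<in> C"
    have "- p (- v) \<le> - q (- v)" using le[OF q] by (simp add: le_fun_def)
    then show "- p (- v) \<le> q v" using sublinear_neg[OF sub[OF q], of v] by linarith
  qed
  show lower: "(INF q\<in>C. q v) \<le> r v" if "r \<in> C" for r v
    using that bdd by (intro cINF_lower)
  show "sublinear (\<lambda>v. INF q\<in>C. q v)"
    unfolding sublinear_def
  proof (intro conjI allI impI)
    fix u v
    have *: "(INF q\<in>C. q (u + v)) \<le> q u + r v" if "q \<in> C" "r \<in> C" for q r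
    proof -
      from chain[OF that] that obtain s where s: "s \<in> C" "s \<le> q" "s \<le> r" by blast
      have "(INF q\<in>C. q (u + v)) \<le> s u + s v"
        using lower[OF s(1), of "u + v"] sublinear_add[OF sub[OF s(1)], of u v] by linarith
      also have "\<dots> \<le> q u + r v" using s by (intro add_mono) (auto simp: le_fun_def)
      finally show ?thesis .
    qed
    have "(INF q\<in>C. q (u + v)) - q u \<le> (INF r\<in>C. r v)" if "q \<in> C" for q
      using \<open>C \<noteq> {}\<close> *[OF that] by (intro cINF_greatest) (auto simp: algebra_simps)
    then have "(INF q\<in>C. q (u + v)) - (INF r\<in>C. r v) \<le> (INF q\<in>C. q u)"
      using \<open>C \<noteq> {}\<close> by (intro cINF_greatest) (auto simp: algebra_simps)
    then show "(INF q\<in>C. q (u + v)) \<le> (INF q\<in>C. q u) + (INF q\<in>C. q v)"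
      by linarith
  next
    fix t :: real and v :: 'a assume "t \<ge> 0"
    have eq: "(INF q\<in>C. q (t *\<^sub>R v)) = (INF q\<in>C. t * q v)"
      using \<open>t \<ge> 0\<close> sub by (intro INF_cong) (auto simp: sublinear_scale)
    show "(INF q\<in>C. q (t *\<^sub>R v)) = t * (INF q\<in>C. q v)"
    proof (cases "t = 0")
      case True
      then show ?thesis using eq \<open>C \<noteq> {}\<close> by simp
    next
      case False
      with \<open>t \<ge> 0\<close> have "t > 0" by simp
      have "(INF q\<in>C. t * q v) \<le> t * (INF q\<in>C. q v)"
      proof -
        have "(INF q\<in>C. t * q v) / t \<le> (INF q\<in>C. q v)"
        proof (rule cINF_greatest[OF \<open>C \<noteq> {}\<close>])
          fix q assume "q \<in> C"
          have "(INF q\<in>C. q (t *\<^sub>R v)) \<le> t * q v"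
            using lower[OF \<open>q \<in> C\<close>, of "t *\<^sub>R v"] sublinear_scale[OF sub[OF \<open>q \<in> C\<close>] \<open>t \<ge> 0\<close>] by simp
          then show "(INF q\<in>C. t * q v) / t \<le> q v"
            using eq \<open>t > 0\<close> by (simp add: field_simps)
        qed
        then show ?thesis using \<open>t > 0\<close> by (simp add: field_simps)
      qed
      moreover have "t * (INF q\<in>C. q v) \<le> (INF q\<in>C. t * q v)"
        using \<open>C \<noteq> {}\<close> \<open>t \<ge> 0\<close> by (intro cINF_greatest mult_left_mono lower) auto
      ultimately show ?thesis using eq by simp
    qed
  qed
qed

lemma sublinear_minimal_additive:
  fixes p :: "'a::real_vector \<Rightarrow> real"
  assumes p: "sublinear p" and min: "\<And>q. sublinear q \<Longrightarrow> q \<le> p \<Longrightarrow> q = p"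
  shows "p (u + v) = p u + p v"
proof -
  \<comment> \<open>\<open>q\<close> is a sublinear minorant of \<open>p\<close>, hence equals \<open>p\<close>; then \<open>t = 1\<close> gives superadditivity.\<close>
  define q where "q w = (INF t\<in>{0..}. p (w + t *\<^sub>R v) - t * p v)" for w
  have bdd: "bdd_below ((\<lambda>t. p (w + t *\<^sub>R v) - t * p v) ` {0..})" for w
  proof (rule bdd_belowI2)
    fix t :: real assume "t \<in> {0..}"
    then have "t * p v = p ((w + t *\<^sub>R v) + (- w))"
      using sublinear_scale[OF p, of t v] by simp
    also have "\<dots> \<le> p (w + t *\<^sub>R v) + p (- w)" by (rule sublinear_add[OF p])
    finally show "- p (- w) \<le> p (w + t *\<^sub>R v) - t * p v" by simp
  qed
  have lower: "q w \<le> p (w + t *\<^sub>R v) - t * p v" if "t \<ge> 0" for t w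
    unfolding q_def using that by (intro cINF_lower bdd) auto
  have greatest: "b \<le> q w" if "\<And>t. t \<ge> 0 \<Longrightarrow> b \<le> p (w + t *\<^sub>R v) - t * p v" for b w
    unfolding q_def using that by (intro cINF_greatest) auto
  \<comment> \<open>One inequality for all positive factors is enough: applied with
    \<open>1 / s\<close> to \<open>s *\<^sub>R w\<close> it yields the converse.\<close>
  have scale_le: "q (s *\<^sub>R w) \<le> s * q w" if "s > 0" for s w
  proof -
    have "q (s *\<^sub>R w) / s \<le> q w"
    proof (rule greatest)
      fix t :: real assume "t \<ge> 0"
      then have "q (s *\<^sub>R w) \<le> p (s *\<^sub>R w + (s * t) *\<^sub>R v) - (s * t) * p v"
        using \<open>s > 0\<close> by (intro lower) auto
      also have "s *\<^sub>R w + (s * t) *\<^sub>R v = s *\<^sub>R (w + t *\<^sub>R v)" by (simp add: algebra_simps)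
      also have "p \<dots> = s * p (w + t *\<^sub>R v)" using \<open>s > 0\<close> by (simp add: sublinear_scale[OF p])
      finally show "q (s *\<^sub>R w) / s \<le> p (w + t *\<^sub>R v) - t * p v"
        using \<open>s > 0\<close> by (simp add: field_simps)
    qed
    then show ?thesis using \<open>s > 0\<close> by (simp add: field_simps)
  qed
  have q0: "q 0 = 0"
  proof (rule antisym)
    show "q 0 \<le> 0" using lower[of 0 0] sublinear_zero[OF p] by simp
    show "0 \<le> q 0" by (rule greatest) (simp add: sublinear_scale[OF p])
  qed
  have "sublinear q"
    unfolding sublinear_def
  proof (intro conjI allI impI)
    fix w z
    have "q (w + z) - (p (z + t *\<^sub>R v) - t * p v) \<le> q w" if "t \<ge> 0" for t
    proof (rule greatest)
      fix s :: real assume "s \<ge> 0"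
      then have "q (w + z) \<le> p ((w + z) + (s + t) *\<^sub>R v) - (s + t) * p v"
        using that by (intro lower) auto
      also have "(w + z) + (s + t) *\<^sub>R v = (w + s *\<^sub>R v) + (z + t *\<^sub>R v)"
        by (simp add: algebra_simps)
      also have "p \<dots> \<le> p (w + s *\<^sub>R v) + p (z + t *\<^sub>R v)" by (rule sublinear_add[OF p])
      finally show "q (w + z) - (p (z + t *\<^sub>R v) - t * p v) \<le> p (w + s *\<^sub>R v) - s * p v"
        by (simp add: algebra_simps)
    qed
    then have "q (w + z) - q w \<le> q z" by (intro greatest) (simp add: algebra_simps)
    then show "q (w + z) \<le> q w + q z" by simp
  next
    fix s :: real and w assume "s \<ge> 0"
    show "q (s *\<^sub>R w) = s * q w"
    proof (cases "s = 0")
      case False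
      with \<open>s \<ge> 0\<close> have "s > 0" by simp
      have "q ((1 / s) *\<^sub>R s *\<^sub>R w) \<le> (1 / s) * q (s *\<^sub>R w)"
        using \<open>s > 0\<close> by (intro scale_le) auto
      then have "s * q w \<le> q (s *\<^sub>R w)" using \<open>s > 0\<close> by (simp add: field_simps)
      with scale_le[OF \<open>s > 0\<close>, of w] show ?thesis by simp
    qed (simp add: q0)
  qed
  moreover have "q \<le> p" using lower[of 0] by (simp add: le_fun_def)
  ultimately have "q = p" by (rule min)
  then have "p u + p v \<le> p (u + v)" using lower[of 1 u] by simp
  with sublinear_add[OF p, of u v] show ?thesis by simp
qed

text \<open>Zorn's lemma gives a minimal sublinear functional below \<open>p\<close>. Minimality
  makes it additive, additivity makes it odd, and together with positive homogeneity this is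
  linearity.\<close>

theorem sublinear_dominates_linear:
  fixes p :: "'a::real_vector \<Rightarrow> real"
  assumes p: "sublinear p"
  obtains f where "linear f" and "\<And>v. f v \<le> p v"
proof -
  define A where "A = {q. sublinear q \<and> q \<le> p}"
  \<comment> \<open>The order is reversed, so that the maximal element of Zorn's lemma is a minimal
    functional.\<close>
  let ?P = "\<lambda>q r :: 'a \<Rightarrow> real. r \<le> q"
  have "\<exists>m\<in>A. \<forall>a\<in>A. ?P m a \<longrightarrow> a = m"
  proof (rule predicate_Zorn)
    show "partial_order_on A (relation_of ?P A)"
      by (rule partial_order_on_relation_ofI) auto
    fix C assume C: "C \<in> Chains (relation_of ?P A)"
    show "\<exists>u\<in>A. \<forall>a\<in>C. ?P a u"
    proof (cases "C = {}")
      case True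
      then show ?thesis using p by (auto simp: A_def)
    next
      case False
      have sub: "sublinear q" "q \<le> p" if "q \<in> C" for q
        using C that by (auto simp: Chains_def relation_of_def A_def)
      have chain: "q \<le> r \<or> r \<le> q" if "q \<in> C" "r \<in> C" for q r
        using C that by (auto simp: Chains_def relation_of_def)
      define m where "m v = (INF q\<in>C. q v)" for v
      have "sublinear m" unfolding m_def
        by (rule sublinear_INF_chain(1)[OF False sub(1) chain sub(2)])
      moreover have m: "m \<le> q" if "q \<in> C" for q unfolding m_def le_fun_def
        using sublinear_INF_chain(2)[OF False sub(1) chain sub(2) that] by blast
      moreover have "m \<le> p" using False m sub(2) by (meson ex_in_conv order_trans)
      ultimately show ?thesis by (auto simp: A_def)
    qed
  qed
  then obtain m where m: "sublinear m" "m \<le> p"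
    and min: "\<And>q. sublinear q \<Longrightarrow> q \<le> p \<Longrightarrow> q \<le> m \<Longrightarrow> q = m"
    by (auto simp: A_def)
  have add: "m (u + v) = m u + m v" for u v
    by (rule sublinear_minimal_additive[OF m(1)]) (use min m in \<open>auto intro: order_trans\<close>)
  have neg: "m (- v) = - m v" for v
    using add[of v "- v"] sublinear_zero[OF m(1)] by simp
  have "m (t *\<^sub>R v) = t * m v" for t v
  proof (cases "t \<ge> 0")
    case False
    then show ?thesis using sublinear_scale[OF m(1), of "- t" v] neg[of "t *\<^sub>R v"] by simp
  qed (simp add: sublinear_scale[OF m(1)])
  then have "linear m" using add by (intro linearI) auto
  then show thesis using that m(2) by (simp add: le_fun_def)
qed

section \<open>Separation from a ball and Mazur's theorem\<close>

text \<open>Separates \<open>S\<close> from the open ball of radius \<delta> about 0. The functional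
  is taken below the infimum \<open>p v\<close> of
  \<open>norm (v + t *\<^sub>R s) - \<delta> * t\<close>: this \<open>p\<close> lies below the norm,
  which bounds \<open>f\<close>, and \<open>t = 1\<close> gives
  \<open>p (- s) \<le> - \<delta>\<close>, which forces \<open>\<delta> \<le> f s\<close>.\<close>

theorem convex_bounded_away_functional:
  fixes S :: "'a::real_normed_vector set"
  assumes "convex S" and norm: "\<And>s. s \<in> S \<Longrightarrow> \<delta> \<le> norm s"
  obtains f where "bounded_linear f" and "\<And>s. s \<in> S \<Longrightarrow> \<delta> \<le> f s"
proof (cases "S = {}")
  case True
  then show thesis using that[of "\<lambda>_. 0"] by simp
next
  case False
  define D where "D = {0::real..} \<times> S"
  define g where "g v = (\<lambda>(t, s). norm (v + t *\<^sub>R s) - \<delta> * t)" for v :: 'a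
  define p where "p v = (INF d\<in>D. g v d)" for v
  have "D \<noteq> {}" using False by (auto simp: D_def)
  have bdd: "bdd_below (g v ` D)" for v
  proof (rule bdd_belowI2)
    fix d assume "d \<in> D"
    then obtain t s where d: "d = (t, s)" "t \<ge> 0" "s \<in> S" by (auto simp: D_def)
    have "\<delta> * t \<le> norm (t *\<^sub>R s)" using mult_left_mono[OF norm[OF d(3)] d(2)] d(2) by (simp add: mult.commute)
    also have "\<dots> \<le> norm (v + t *\<^sub>R s) + norm v"
      using norm_triangle_ineq4[of "v + t *\<^sub>R s" v] by simp
    finally show "- norm v \<le> g v d" by (simp add: g_def d)
  qed
  have lower: "p v \<le> norm (v + t *\<^sub>R s) - \<delta> * t" if "t \<ge> 0" "s \<in> S" for v t s
    using cINF_lower[OF bdd, of "(t, s)" v] that by (simp add: p_def g_def D_def)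
  have greatest: "b \<le> p v" if "\<And>t s. t \<ge> 0 \<Longrightarrow> s \<in> S \<Longrightarrow> b \<le> norm (v + t *\<^sub>R s) - \<delta> * t" for b v
    unfolding p_def using that \<open>D \<noteq> {}\<close> by (intro cINF_greatest) (auto simp: g_def D_def)
  have le_norm: "p v \<le> norm v" for v
    using False lower[of 0 _ v] by auto
  have scale_le: "p (r *\<^sub>R v) \<le> r * p v" if "r > 0" for r v
  proof -
    have "p (r *\<^sub>R v) / r \<le> p v"
    proof (rule greatest)
      fix t s assume ts: "t \<ge> (0::real)" "s \<in> S"
      then have "p (r *\<^sub>R v) \<le> norm (r *\<^sub>R v + (r * t) *\<^sub>R s) - \<delta> * (r * t)"
        using \<open>r > 0\<close> by (intro lower) auto
      also have "r *\<^sub>R v + (r * t) *\<^sub>R s = r *\<^sub>R (v + t *\<^sub>R s)" by (simp add: algebra_simps)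
      also have "norm \<dots> = r * norm (v + t *\<^sub>R s)" using \<open>r > 0\<close> by simp
      finally show "p (r *\<^sub>R v) / r \<le> norm (v + t *\<^sub>R s) - \<delta> * t"
        using \<open>r > 0\<close> by (simp add: field_simps)
    qed
    then show ?thesis using \<open>r > 0\<close> by (simp add: field_simps)
  qed
  have p0: "p 0 = 0"
  proof (rule antisym)
    show "p 0 \<le> 0" using le_norm[of 0] by simp
    show "0 \<le> p 0"
      by (rule greatest) (use norm in \<open>auto simp: mult_left_mono mult.commute[of \<delta>]\<close>)
  qed
  have "sublinear p"
    unfolding sublinear_def
  proof (intro conjI allI impI)
    fix u v
    have *: "p (u + v) \<le> (norm (u + t *\<^sub>R s) - \<delta> * t) + (norm (v + t' *\<^sub>R s') - \<delta> * t')"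
      if "t \<ge> 0" "s \<in> S" "t' \<ge> 0" "s' \<in> S" for t s t' s'
    proof (cases "t + t' = 0")
      case True
      then have "t = 0" "t' = 0" using that by auto
      then show ?thesis
        using order_trans[OF le_norm[of "u + v"] norm_triangle_ineq[of u v]] by simp
    next
      case False
      then have pos: "t + t' > 0" using that by simp
      \<comment> \<open>Convexity of \<open>S\<close> enters here: this weighted mean merges the two
        pairs \<open>(t, s)\<close> and \<open>(t', s')\<close> into the single pair
        \<open>(t + t', z)\<close>. The weights need \<open>t + t'\<close> to be nonzero, hence the
        case distinction.\<close>
      define z where "z = (t / (t + t')) *\<^sub>R s + (t' / (t + t')) *\<^sub>R s'"
      have "z \<in> S" unfolding z_def
        using pos that \<open>convex S\<close> by (intro convexD) (auto simp: add_divide_distrib[symmetric])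
      then have "p (u + v) \<le> norm ((u + v) + (t + t') *\<^sub>R z) - \<delta> * (t + t')"
        using that by (intro lower) auto
      also have "(u + v) + (t + t') *\<^sub>R z = (u + t *\<^sub>R s) + (v + t' *\<^sub>R s')"
        using pos by (simp add: z_def scaleR_add_right)
      also have "norm \<dots> \<le> norm (u + t *\<^sub>R s) + norm (v + t' *\<^sub>R s')" by (rule norm_triangle_ineq)
      finally show ?thesis by (simp add: algebra_simps)
    qed
    have "p (u + v) - (norm (v + t *\<^sub>R s) - \<delta> * t) \<le> p u" if "t \<ge> 0" "s \<in> S" for t s
      using *[OF _ _ that] by (intro greatest) (simp add: algebra_simps)
    then have "p (u + v) - p u \<le> p v" by (intro greatest) (simp add: algebra_simps)
    then show "p (u + v) \<le> p u + p v" by simp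
  next
    fix r :: real and v assume "r \<ge> 0"
    show "p (r *\<^sub>R v) = r * p v"
    proof (cases "r = 0")
      case False
      with \<open>r \<ge> 0\<close> have "r > 0" by simp
      have "p ((1 / r) *\<^sub>R r *\<^sub>R v) \<le> (1 / r) * p (r *\<^sub>R v)"
        using \<open>r > 0\<close> by (intro scale_le) auto
      then have "r * p v \<le> p (r *\<^sub>R v)" using \<open>r > 0\<close> by (simp add: field_simps)
      with scale_le[OF \<open>r > 0\<close>, of v] show ?thesis by simp
    qed (simp add: p0)
  qed
  then obtain f where f: "linear f" "\<And>v. f v \<le> p v" by (rule sublinear_dominates_linear) blast
  have "f v \<le> norm v" "- f v \<le> norm v" for v
    using order_trans[OF f(2) le_norm, of v] order_trans[OF f(2) le_norm, of "- v"] linear_neg[OF f(1), of v] by auto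
  then have "bounded_linear f"
    using linear_add[OF f(1)] linear_scale[OF f(1)]
    by (intro bounded_linear_intro[where K = 1]) (auto simp: abs_le_iff)
  moreover have "\<delta> \<le> f s" if "s \<in> S" for s
    using order_trans[OF f(2) lower[of 1 s "- s"]] that linear_neg[OF f(1), of s] by simp
  ultimately show thesis by (rule that)
qed

text \<open>Mazur's theorem for weakly null families. If all convex combinations had norm at least
  \<delta>, a bounded functional would be at least \<delta> at infinitely many indices, against weak
  nullness. A convex combination involves finitely many vectors, so a finite index set
  \<open>T\<close> suffices.\<close>

lemma weakly_null_small_convex_combination:
  fixes y :: "'i \<Rightarrow> 'a::real_normed_vector"
  assumes null: "weakly_null_on I y" and M: "M \<subseteq> I" "infinite M" and "\<delta> > 0"
  obtains T z where "finite T" "T \<subseteq> M" "z \<in> convex hull (y ` T)" "norm z < \<delta>"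
proof -
  have "\<exists>z\<in>convex hull (y ` M). norm z < \<delta>"
  proof (rule ccontr)
    assume "\<not> ?thesis"
    then have *: "\<And>z. z \<in> convex hull (y ` M) \<Longrightarrow> \<delta> \<le> norm z" by force
    obtain f where f: "bounded_linear f" "\<And>z. z \<in> convex hull (y ` M) \<Longrightarrow> \<delta> \<le> f z"
      using * that by (rule convex_bounded_away_functional[OF convex_convex_hull])
    \<comment> \<open>Halving turns the weak inequality from separation into the strict one that
      weak nullness speaks of.\<close>
    have "\<delta> / 2 < \<bar>f (y i)\<bar>" if "i \<in> M" for i
      using f(2)[OF hull_inc, of "y i"] that \<open>\<delta> > 0\<close> by force
    then have "M \<subseteq> {i \<in> I. \<bar>f (y i)\<bar> > \<delta> / 2}" using M by auto
    moreover have "finite {i \<in> I. \<bar>f (y i)\<bar> > \<delta> / 2}"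
      using null f(1) half_gt_zero[OF \<open>\<delta> > 0\<close>] unfolding weakly_null_on_def by blast
    ultimately show False using M finite_subset by blast
  qed
  then obtain z where z: "z \<in> convex hull (y ` M)" "norm z < \<delta>" by blast
  then obtain S u where S: "finite S" "S \<subseteq> y ` M" "\<forall>s\<in>S. 0 \<le> u s" "sum u S = 1" "(\<Sum>s\<in>S. u s *\<^sub>R s) = z"
    unfolding convex_hull_explicit by blast
  obtain T where "T \<subseteq> M" "finite T" "S = y ` T"
    using finite_subset_image[OF S(1,2)] by blast
  moreover have "z \<in> convex hull S" unfolding convex_hull_explicit using S by blast
  ultimately show thesis using that z(2) by blast
qed

section \<open>Positions in finite sets of natural numbers\<close>

text \<open>The position of \<open>k\<close> in the increasing enumeration of \<open>F\<close>,
  counted from 0. Attaching coefficients to positions lets one coefficient vector serve all sets of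
  the same size.\<close>

definition rank :: "nat set \<Rightarrow> nat \<Rightarrow> nat"
  where "rank F k = card {l \<in> F. l < k}"

lemma rank_strict_mono: "finite F \<Longrightarrow> k \<in> F \<Longrightarrow> k < l \<Longrightarrow> rank F k < rank F l"
  unfolding rank_def by (intro psubset_card_mono) auto

lemma inj_on_rank: "finite F \<Longrightarrow> inj_on (rank F) F"
  by (rule linorder_inj_onI) (use rank_strict_mono in \<open>force+\<close>)

lemma rank_less_card: "finite F \<Longrightarrow> k \<in> F \<Longrightarrow> rank F k < card F"
  unfolding rank_def by (intro psubset_card_mono) auto

text \<open>Shows that moving \<open>t\<close> inside the gap between \<open>P\<close> and
  \<open>Q\<close> changes no position, so the coefficients of the other terms do not depend on
  \<open>t\<close>.\<close>

lemma rank_insert_between: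
  assumes "finite P" "finite Q" and P: "\<And>k. k \<in> P \<Longrightarrow> k < t" and Q: "\<And>k. k \<in> Q \<Longrightarrow> t < k"
  shows "rank (insert t (P \<union> Q)) t = card P"
    and "k \<in> P \<Longrightarrow> rank (insert t (P \<union> Q)) k = rank P k"
    and "k \<in> Q \<Longrightarrow> rank (insert t (P \<union> Q)) k = Suc (card P + rank Q k)"
proof -
  have "{l \<in> insert t (P \<union> Q). l < t} = P" using P Q by force
  then show "rank (insert t (P \<union> Q)) t = card P" by (simp add: rank_def)
  show "rank (insert t (P \<union> Q)) k = rank P k" if "k \<in> P"
    unfolding rank_def by (rule arg_cong[where f = card]) (use P Q that in force)
  show "rank (insert t (P \<union> Q)) k = Suc (card P + rank Q k)" if "k \<in> Q"
  proof -
    have "{l \<in> insert t (P \<union> Q). l < k} = insert t (P \<union> {l \<in> Q. l < k})"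
      using P Q that by force
    moreover have "P \<inter> {l \<in> Q. l < k} = {}" "t \<notin> P \<union> {l \<in> Q. l < k}" using P Q by force+
    ultimately show ?thesis
      using assms(1,2) by (simp add: rank_def card_Un_disjoint)
  qed
qed

section \<open>Averaging one term over a block\<close>

text \<open>The set is the preimage of a ball under a linear map. Convexity carries a norm bound
  from all terms of a block to their convex combinations.\<close>

lemma convex_norm_affine_le: "convex {u. norm (v + e *\<^sub>R u) \<le> r}"
proof -
  have "norm (- v - w) = norm (v + w)" for w
    using norm_minus_cancel[of "v + w"] by simp
  then have "{u. norm (v + e *\<^sub>R u) \<le> r} = (\<lambda>u. e *\<^sub>R u) -` cball (- v) r"
    by (auto simp: dist_norm)
  then show ?thesis by (simp add: convex_linear_vimage)
qed

lemma infinite_above_finite: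
  fixes Y :: "nat set"
  assumes "infinite Y" "finite P"
  shows "infinite {m \<in> Y. \<forall>k\<in>P. k < m}"
proof
  assume "finite {m \<in> Y. \<forall>k\<in>P. k < m}"
  then have "finite ({m \<in> Y. \<forall>k\<in>P. k < m} \<union> (\<Union>k\<in>P. {..k}))" using assms by simp
  then have "finite Y" by (rule rev_finite_subset) (auto simp: not_less)
  then show False using assms by simp
qed

text \<open>Suppose dropping the term at position \<open>p\<close> always raised the norm by more
  than \<eta>. Keep the other terms fixed, with sum \<open>v\<close>, and let that term run through
  a block \<open>T\<close>. The bound \<open>norm v - \<eta>\<close> for
  \<open>v + g p *\<^sub>R y t\<close> passes to a convex combination \<open>z\<close> of the block
  with \<open>norm z < \<eta>\<close>, which is impossible because
  \<open>\<bar>g p\<bar> \<le> 1\<close>.\<close>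

lemma no_uniform_coefficient_loss:
  fixes y :: "nat \<Rightarrow> 'a::real_normed_vector"
  assumes null: "weakly_null_on UNIV y" and "infinite Y" and "\<eta> > 0" and "p < n"
    and g: "\<And>r. r < n \<Longrightarrow> \<bar>g r\<bar> \<le> 1"
  obtains F i where "F \<subseteq> Y" "finite F" "card F = n" "i \<in> F" "rank F i = p"
    "norm (\<Sum>k\<in>F - {i}. g (rank F k) *\<^sub>R y k) \<le> norm (\<Sum>k\<in>F. g (rank F k) *\<^sub>R y k) + \<eta>"
proof (rule ccontr)
  assume "\<not> thesis"
  note witness = that
  have loss: "norm (\<Sum>k\<in>F. g (rank F k) *\<^sub>R y k) + \<eta> < norm (\<Sum>k\<in>F - {i}. g (rank F k) *\<^sub>R y k)"
    if "F \<subseteq> Y" "finite F" "card F = n" "i \<in> F" "rank F i = p" for F i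
    using witness[OF that] \<open>\<not> thesis\<close> by linarith
  obtain P where P: "finite P" "card P = p" "P \<subseteq> Y"
    using infinite_arbitrarily_large[OF \<open>infinite Y\<close>] by blast
  \<comment> \<open>The block lies above all \<open>p\<close> elements of \<open>P\<close>, and
    \<open>Q\<close> is later chosen above the block, so every \<open>t\<close> in \<open>T\<close>
    takes position \<open>p\<close>.\<close>
  obtain T z where T: "finite T" "T \<subseteq> {m \<in> Y. \<forall>k\<in>P. k < m}"
    and z: "z \<in> convex hull (y ` T)" "norm z < \<eta>"
    using weakly_null_small_convex_combination[OF null subset_UNIV
        infinite_above_finite[OF \<open>infinite Y\<close> P(1)] \<open>\<eta> > 0\<close>] by blast
  have "infinite {m \<in> Y. \<forall>k\<in>P \<union> T. k < m}"
    using P(1) T(1) by (intro infinite_above_finite[OF \<open>infinite Y\<close>]) simp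
  from infinite_arbitrarily_large[OF this, of "n - Suc p"]
  obtain Q where Q: "finite Q" "card Q = n - Suc p" "Q \<subseteq> {m \<in> Y. \<forall>k\<in>P \<union> T. k < m}"
    by blast
  \<comment> \<open>The coefficient that \<open>k\<close> receives in
    \<open>insert t (P \<union> Q)\<close> for any \<open>t\<close> in \<open>T\<close>; the
    \<open>Suc\<close> accounts for \<open>t\<close> itself.\<close>
  define a where "a k = g (if k \<in> P then rank P k else Suc (p + rank Q k))" for k
  define v where "v = (\<Sum>k\<in>P \<union> Q. a k *\<^sub>R y k)"
  have "norm (v + g p *\<^sub>R y t) \<le> norm v - \<eta>" if "t \<in> T" for t
  proof -
    define F where "F = insert t (P \<union> Q)"
    have between: "\<And>k. k \<in> P \<Longrightarrow> k < t" "\<And>k. k \<in> Q \<Longrightarrow> t < k" using T Q that by auto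
    have disj: "P \<inter> Q = {}" using between by force
    have t: "t \<notin> P \<union> Q" using between by blast
    have F: "F \<subseteq> Y" "finite F" using P T Q that by (auto simp: F_def)
    have card: "card F = n"
      using P Q t disj \<open>p < n\<close> by (simp add: F_def card_Un_disjoint)
    have rank: "rank F t = p" "\<And>k. k \<in> P \<union> Q \<Longrightarrow> g (rank F k) = a k"
      using rank_insert_between[OF P(1) Q(1) between] disj P(2) unfolding F_def a_def by auto
    have "F - {t} = P \<union> Q" using t by (auto simp: F_def)
    then have "(\<Sum>k\<in>F - {t}. g (rank F k) *\<^sub>R y k) = v" using rank(2) by (simp add: v_def)
    moreover from this have "(\<Sum>k\<in>F. g (rank F k) *\<^sub>R y k) = v + g p *\<^sub>R y t"
      using sum.remove[OF F(2), of t "\<lambda>k. g (rank F k) *\<^sub>R y k"] rank(1)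
      by (simp add: F_def add.commute)
    ultimately show ?thesis using loss[OF F card _ rank(1)] by (simp add: F_def)
  qed
  then have "convex hull (y ` T) \<subseteq> {u. norm (v + g p *\<^sub>R u) \<le> norm v - \<eta>}"
    by (intro hull_minimal convex_norm_affine_le) auto
  then have "norm (v + g p *\<^sub>R z) \<le> norm v - \<eta>" using z by auto
  moreover have "norm v \<le> norm (v + g p *\<^sub>R z) + norm (g p *\<^sub>R z)"
    using norm_triangle_ineq4[of "v + g p *\<^sub>R z" "g p *\<^sub>R z"] by simp
  moreover have "norm (g p *\<^sub>R z) \<le> norm z"
    using g[OF \<open>p < n\<close>] mult_right_mono[of "\<bar>g p\<bar>" 1 "norm z"] by simp
  ultimately show False using z by linarith
qed

section \<open>Rounding of coefficients and Ramsey's theorem\<close>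

text \<open>Rounding to multiples of \<open>1 / N\<close> leaves finitely many coefficient vectors,
  as a finite colouring requires. Each term moves by at most \<open>1 / N\<close>. One
  \<open>d\<close> serves all subsets \<open>G\<close>, so the sums with and without a term can be
  compared.\<close>

lemma discretize_coefficients:
  fixes y :: "nat \<Rightarrow> 'a::real_normed_vector"
  assumes "finite F" "card F = n" and y: "\<And>k. k \<in> F \<Longrightarrow> norm (y k) \<le> 1"
    and c: "\<And>k. k \<in> F \<Longrightarrow> \<bar>c k\<bar> \<le> 1" and "N > 0"
  obtains d :: "nat \<Rightarrow> int" where "d \<in> {..<n} \<rightarrow>\<^sub>E {- int N..int N}"
    "\<And>G. G \<subseteq> F \<Longrightarrow> \<bar>norm (\<Sum>k\<in>G. (d (rank F k) / N) *\<^sub>R y k) - norm (\<Sum>k\<in>G. c k *\<^sub>R y k)\<bar> \<le> n / N"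
proof
  \<comment> \<open>The inverse of \<open>rank F\<close> finds the element at position
    \<open>r\<close>. Restricting to \<open>{..<n}\<close> places \<open>d\<close> in a finite
    function space.\<close>
  define d where "d = (\<lambda>r\<in>{..<n}. \<lfloor>N * c (inv_into F (rank F) r)\<rfloor>)"
  have img: "rank F ` F = {..<n}"
  proof (rule card_subset_eq)
    show "rank F ` F \<subseteq> {..<n}" using rank_less_card[OF assms(1)] assms(2) by auto
    show "card (rank F ` F) = card {..<n}" using card_image[OF inj_on_rank[OF assms(1)]] assms(2) by simp
  qed simp
  show "d \<in> {..<n} \<rightarrow>\<^sub>E {- int N..int N}"
  proof (rule PiE_I)
    fix r assume r: "r \<in> {..<n}"
    then have "\<bar>c (inv_into F (rank F) r)\<bar> \<le> 1" by (intro c inv_into_into) (simp add: img)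
    then have "\<bar>N * c (inv_into F (rank F) r)\<bar> \<le> N"
      using mult_left_mono[of _ 1 "real N"] by (simp add: abs_mult)
    then have "- real_of_int N \<le> N * c (inv_into F (rank F) r)" "N * c (inv_into F (rank F) r) \<le> real_of_int N"
      by auto
    then have "- int N \<le> \<lfloor>N * c (inv_into F (rank F) r)\<rfloor>" "\<lfloor>N * c (inv_into F (rank F) r)\<rfloor> \<le> int N"
      by (auto simp: le_floor_iff floor_le_iff)
    then show "d r \<in> {- int N..int N}" using r by (simp add: d_def)
  qed (simp add: d_def)
  fix G assume "G \<subseteq> F"
  have summand: "norm ((d (rank F k) / N) *\<^sub>R y k - c k *\<^sub>R y k) \<le> 1 / N" if "k \<in> G" for k
  proof -
    have "k \<in> F" using that \<open>G \<subseteq> F\<close> by blast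
    then have "d (rank F k) = \<lfloor>N * c k\<rfloor>"
      using img inj_on_rank[OF assms(1)] by (auto simp: d_def inv_into_f_f)
    then have "\<bar>d (rank F k) - N * c k\<bar> \<le> 1" by linarith
    then have "\<bar>d (rank F k) / N - c k\<bar> \<le> 1 / N"
      using \<open>N > 0\<close> by (simp add: abs_le_iff field_simps)
    then have "\<bar>d (rank F k) / N - c k\<bar> * norm (y k) \<le> 1 / N * 1"
      using y[OF \<open>k \<in> F\<close>] by (intro mult_mono) auto
    then show ?thesis by (simp flip: scaleR_diff_left)
  qed
  have "\<bar>norm (\<Sum>k\<in>G. (d (rank F k) / N) *\<^sub>R y k) - norm (\<Sum>k\<in>G. c k *\<^sub>R y k)\<bar>
      \<le> norm (\<Sum>k\<in>G. (d (rank F k) / N) *\<^sub>R y k - c k *\<^sub>R y k)"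
    by (simp add: sum_subtractf norm_triangle_ineq3)
  also have "\<dots> \<le> card G * (1 / N)" using sum_norm_bound[OF summand] by simp
  also have "\<dots> \<le> n / N"
    using card_mono[OF assms(1) \<open>G \<subseteq> F\<close>] assms(2) by (simp add: divide_right_mono)
  finally show "\<bar>norm (\<Sum>k\<in>G. (d (rank F k) / N) *\<^sub>R y k) - norm (\<Sum>k\<in>G. c k *\<^sub>R y k)\<bar> \<le> n / N" .
qed

text \<open>If every \<open>n\<close>-set failed, each would fail at some position with some rounded
  coefficients. There are finitely many such pairs, so Ramsey's theorem makes one pair fail on all
  \<open>n\<close>-subsets of an infinite set, which \<open>no_uniform_coefficient_loss\<close>
  excludes.\<close>

lemma weakly_null_almost_suppression_single:
  fixes y :: "nat \<Rightarrow> 'a::real_normed_vector"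
  assumes null: "weakly_null_on UNIV y" and y: "\<And>k. norm (y k) \<le> 1" and "\<eta> > 0"
  obtains F where "finite F" "card F = n"
    "\<And>c i. (\<And>k. k \<in> F \<Longrightarrow> \<bar>c k\<bar> \<le> 1) \<Longrightarrow> i \<in> F \<Longrightarrow>
      norm (\<Sum>k\<in>F - {i}. c k *\<^sub>R y k) \<le> norm (\<Sum>k\<in>F. c k *\<^sub>R y k) + \<eta>"
proof (rule ccontr)
  assume not: "\<not> thesis"
  note witness = that
  \<comment> \<open>Rounding affects two norms by at most \<open>\<eta> / 4\<close> each, so a gap
    of \<open>\<eta> / 2\<close> survives. The \<open>Suc\<close> keeps \<open>N\<close>
    positive.\<close>
  define N where "N = Suc (nat \<lceil>4 * n / \<eta>\<rceil>)"
  have "N > 0" by (simp add: N_def)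
  have "4 * n / \<eta> \<le> N" unfolding N_def by linarith
  then have small: "n / N \<le> \<eta> / 4" using \<open>\<eta> > 0\<close> \<open>N > 0\<close> by (simp add: field_simps)
  define Keys where "Keys = {..<n} \<times> ({..<n} \<rightarrow>\<^sub>E {- int N..int N})"
  define bad where "bad F p d \<longleftrightarrow> (\<exists>i\<in>F. rank F i = p \<and>
    norm (\<Sum>k\<in>F. (d (rank F k) / N) *\<^sub>R y k) + \<eta> / 2 < norm (\<Sum>k\<in>F - {i}. (d (rank F k) / N) *\<^sub>R y k))"
    for F p and d :: "nat \<Rightarrow> int"
  have "\<exists>q\<in>Keys. bad F (fst q) (snd q)" if F: "finite F" "card F = n" for F
  proof -
    obtain c i where c: "\<And>k. k \<in> F \<Longrightarrow> \<bar>c k\<bar> \<le> 1" and i: "i \<in> F"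
      and gt: "norm (\<Sum>k\<in>F. c k *\<^sub>R y k) + \<eta> < norm (\<Sum>k\<in>F - {i}. c k *\<^sub>R y k)"
      using not witness[OF F] by (meson not_le)
    obtain d where d: "d \<in> {..<n} \<rightarrow>\<^sub>E {- int N..int N}"
      and near: "\<And>G. G \<subseteq> F \<Longrightarrow>
        \<bar>norm (\<Sum>k\<in>G. (d (rank F k) / N) *\<^sub>R y k) - norm (\<Sum>k\<in>G. c k *\<^sub>R y k)\<bar> \<le> n / N"
      using y c \<open>N > 0\<close> that by (rule discretize_coefficients[OF F])
    have "norm (\<Sum>k\<in>F. (d (rank F k) / N) *\<^sub>R y k) + \<eta> / 2
        < norm (\<Sum>k\<in>F - {i}. (d (rank F k) / N) *\<^sub>R y k)"
      using near[OF subset_refl] near[OF Diff_subset, of "{i}"] gt small by linarith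
    then have "bad F (rank F i) d"
      unfolding bad_def using i by blast
    moreover have "(rank F i, d) \<in> Keys"
      using d rank_less_card[OF F(1) i] F(2) by (simp add: Keys_def)
    ultimately show ?thesis by force
  qed
  then have "\<exists>q. finite F \<longrightarrow> card F = n \<longrightarrow> q \<in> Keys \<and> bad F (fst q) (snd q)" for F
    by blast
  \<comment> \<open>A chosen failing pair is the colour of \<open>F\<close>; below,
    \<open>enc\<close> numbers the pairs, since Ramsey's theorem is stated for colours below some
    \<open>s\<close>.\<close>
  then obtain key where
    key: "\<And>F. finite F \<Longrightarrow> card F = n \<Longrightarrow> key F \<in> Keys \<and> bad F (fst (key F)) (snd (key F))"
    using choice[of "\<lambda>F q. finite F \<longrightarrow> card F = n \<longrightarrow> q \<in> Keys \<and> bad F (fst q) (snd q)"] by blast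
  have "finite Keys" by (simp add: Keys_def finite_PiE)
  then obtain s and enc :: "nat \<times> (nat \<Rightarrow> int) \<Rightarrow> nat"
    where enc: "enc ` Keys = {i. i < s}" "inj_on enc Keys"
    using finite_imp_inj_to_nat_seg[OF \<open>finite Keys\<close>] by blast
  have "\<exists>Y t. Y \<subseteq> UNIV \<and> infinite Y \<and> t < s \<and>
      (\<forall>F. F \<subseteq> Y \<and> finite F \<and> card F = n \<longrightarrow> enc (key F) = t)"
    by (rule Ramsey) (use key enc(1) in auto)
  then obtain Y t where Y: "infinite Y" "t < s"
    and "\<forall>F. F \<subseteq> Y \<and> finite F \<and> card F = n \<longrightarrow> enc (key F) = t"
    by (elim exE conjE)
  then have hom: "enc (key F) = t" if "F \<subseteq> Y" "finite F" "card F = n" for F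
    using that by simp
  have "t \<in> enc ` Keys" using enc(1) Y(2) by simp
  then obtain q where q: "q \<in> Keys" "enc q = t" by blast
  have bad: "bad F (fst q) (snd q)" if "F \<subseteq> Y" "finite F" "card F = n" for F
  proof -
    have F: "key F \<in> Keys" "bad F (fst (key F)) (snd (key F))" using key that(2,3) by blast+
    have "key F = q" by (rule inj_onD[OF enc(2) _ F(1) q(1)]) (simp only: hom[OF that] q(2))
    then show ?thesis using F(2) by simp
  qed
  obtain p d where pd: "q = (p, d)" by force
  have "p < n" and d: "d \<in> {..<n} \<rightarrow>\<^sub>E {- int N..int N}" using q pd by (auto simp: Keys_def)
  have d1: "\<bar>d r / N\<bar> \<le> 1" if "r < n" for r
  proof -
    have "\<bar>d r\<bar> \<le> int N" using PiE_mem[OF d, of r] that by auto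
    then show ?thesis using \<open>N > 0\<close> by (simp add: abs_divide flip: of_int_abs)
  qed
  obtain F i where F: "F \<subseteq> Y" "finite F" "card F = n" "i \<in> F" "rank F i = p"
    and le: "norm (\<Sum>k\<in>F - {i}. (d (rank F k) / N) *\<^sub>R y k)
      \<le> norm (\<Sum>k\<in>F. (d (rank F k) / N) *\<^sub>R y k) + \<eta> / 2"
    by (rule no_uniform_coefficient_loss[OF null Y(1) half_gt_zero[OF \<open>\<eta> > 0\<close>] \<open>p < n\<close>,
        where g = "\<lambda>r. d r / N"]) (rule d1)
  obtain j where "j \<in> F" "rank F j = p"
    "norm (\<Sum>k\<in>F. (d (rank F k) / N) *\<^sub>R y k) + \<eta> / 2 < norm (\<Sum>k\<in>F - {j}. (d (rank F k) / N) *\<^sub>R y k)"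
    using bad[OF F(1-3)] by (auto simp: bad_def pd)
  \<comment> \<open>Both have position \<open>p\<close> in the same set \<open>F\<close>, and
    positions are injective.\<close>
  moreover have "j = i"
    using inj_onD[OF inj_on_rank[OF F(2)]] F(4,5) calculation(1,2) by metis
  ultimately show False using le by simp
qed

section \<open>From single deletions to suppression unconditionality\<close>

lemma almost_suppression_iterate:
  fixes y :: "'i \<Rightarrow> 'a::real_normed_vector" and \<eta> :: real
  assumes "finite F" and c: "\<And>k. k \<in> F \<Longrightarrow> \<bar>c k\<bar> \<le> 1"
    and single: "\<And>c i. (\<And>k. k \<in> F \<Longrightarrow> \<bar>c k\<bar> \<le> 1) \<Longrightarrow> i \<in> F \<Longrightarrow>
      norm (\<Sum>k\<in>F - {i}. c k *\<^sub>R y k) \<le> norm (\<Sum>k\<in>F. c k *\<^sub>R y k) + \<eta>"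
    and "D \<subseteq> F"
  shows "norm (\<Sum>k\<in>F - D. c k *\<^sub>R y k) \<le> norm (\<Sum>k\<in>F. c k *\<^sub>R y k) + card D * \<eta>"
  using finite_subset[OF \<open>D \<subseteq> F\<close> \<open>finite F\<close>] \<open>D \<subseteq> F\<close>
proof (induction D rule: finite_induct)
  case (insert i D)
  \<comment> \<open>Terms already deleted stay in \<open>F\<close> with coefficient 0, because
    \<open>single\<close> only compares sums over \<open>F\<close> and over \<open>F\<close> without
    one element.\<close>
  define c' where "c' k = (if k \<in> D then 0 else c k)" for k
  have restrict: "(\<Sum>k\<in>G. c' k *\<^sub>R y k) = (\<Sum>k\<in>G - D. c k *\<^sub>R y k)" if "G \<subseteq> F" for G
    using finite_subset[OF that \<open>finite F\<close>]
    by (intro sum.mono_neutral_cong_right) (auto simp: c'_def)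
  have "norm (\<Sum>k\<in>F - {i}. c' k *\<^sub>R y k) \<le> norm (\<Sum>k\<in>F. c' k *\<^sub>R y k) + \<eta>"
    using c insert.prems by (intro single) (auto simp: c'_def)
  then have "norm (\<Sum>k\<in>F - {i} - D. c k *\<^sub>R y k) \<le> norm (\<Sum>k\<in>F - D. c k *\<^sub>R y k) + \<eta>"
    using restrict[of F] restrict[of "F - {i}"] by simp
  moreover have "F - {i} - D = F - insert i D" by auto
  ultimately show ?case using insert by (simp add: algebra_simps)
qed simp

text \<open>The additive error becomes a factor after scaling the largest coefficient to modulus 1.
  Suppressing all other terms then shows that the norm \<open>S\<close> of the whole sum is at least
  \<open>1 - \<zeta>\<close>, so the error \<zeta> is at most \<open>\<epsilon> * S\<close>.\<close>

theorem weakly_null_suppression_unconditional_nset: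
  fixes y :: "nat \<Rightarrow> 'a::real_normed_vector"
  assumes null: "weakly_null_on UNIV y" and norm: "normalized_on UNIV y" and "\<epsilon> > 0"
  obtains F where "finite F" "card F = n" "suppression_unconditional_on (1 + \<epsilon>) F y"
proof -
  have y: "norm (y k) = 1" for k using norm by (simp add: normalized_on_def)
  \<comment> \<open>The solution of \<open>\<epsilon> * (1 - \<zeta>) = \<zeta>\<close>.\<close>
  define \<zeta> where "\<zeta> = \<epsilon> / (1 + \<epsilon>)"
  have "\<zeta> > 0" using \<open>\<epsilon> > 0\<close> by (simp add: \<zeta>_def)
  \<comment> \<open>At most \<open>n\<close> terms are deleted, so the total error stays below
    \<zeta>; \<open>Suc n\<close> avoids division by zero.\<close>
  define \<eta> where "\<eta> = \<zeta> / Suc n"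
  have "\<eta> > 0" using \<open>\<zeta> > 0\<close> by (simp add: \<eta>_def)
  obtain F where F: "finite F" "card F = n"
    and single: "\<And>c i. (\<And>k. k \<in> F \<Longrightarrow> \<bar>c k\<bar> \<le> 1) \<Longrightarrow> i \<in> F \<Longrightarrow>
      norm (\<Sum>k\<in>F - {i}. c k *\<^sub>R y k) \<le> norm (\<Sum>k\<in>F. c k *\<^sub>R y k) + \<eta>"
    using weakly_null_almost_suppression_single[OF null _ \<open>\<eta> > 0\<close>, of n] y by auto
  have additive: "norm (\<Sum>k\<in>A. c k *\<^sub>R y k) \<le> norm (\<Sum>k\<in>F. c k *\<^sub>R y k) + \<zeta>"
    if "A \<subseteq> F" and c: "\<And>k. k \<in> F \<Longrightarrow> \<bar>c k\<bar> \<le> 1" for A c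
  proof -
    have "F - (F - A) = A" using that by auto
    then have "norm (\<Sum>k\<in>A. c k *\<^sub>R y k) \<le> norm (\<Sum>k\<in>F. c k *\<^sub>R y k) + card (F - A) * \<eta>"
      using almost_suppression_iterate[OF F(1) c single, where D = "F - A"] by simp
    moreover have "card (F - A) * \<eta> \<le> Suc n * \<eta>"
      using card_mono[OF F(1), of "F - A"] F(2) \<open>\<eta> > 0\<close> by (intro mult_right_mono) auto
    ultimately show ?thesis by (simp add: \<eta>_def)
  qed
  have "norm (\<Sum>k\<in>A. c k *\<^sub>R y k) \<le> (1 + \<epsilon>) * norm (\<Sum>k\<in>B. c k *\<^sub>R y k)"
    if "A \<subseteq> B" "B \<subseteq> F" for A B c
  proof (cases "\<forall>k\<in>B. c k = 0")
    case True
    then have "(\<Sum>k\<in>A. c k *\<^sub>R y k) = 0" using that by (intro sum.neutral) auto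
    then show ?thesis using \<open>\<epsilon> > 0\<close> by simp
  next
    case False
    have "finite B" using that F(1) finite_subset by blast
    define m where "m = Max ((\<lambda>k. \<bar>c k\<bar>) ` B)"
    have "m \<in> (\<lambda>k. \<bar>c k\<bar>) ` B" unfolding m_def
      using \<open>finite B\<close> False by (intro Max_in) auto
    then obtain j where j: "j \<in> B" "\<bar>c j\<bar> = m" by auto
    have le_m: "\<bar>c k\<bar> \<le> m" if "k \<in> B" for k
      unfolding m_def using \<open>finite B\<close> that by (intro Max_ge) auto
    have "m > 0" using False le_m by force
    \<comment> \<open>Extension by 0 turns sums over \<open>B\<close> into sums over
      \<open>F\<close>, where \<open>additive\<close> applies.\<close>
    define c' where "c' k = (if k \<in> B then c k / m else 0)" for k
    have c': "\<bar>c' k\<bar> \<le> 1" for k using le_m \<open>m > 0\<close> by (simp add: c'_def)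
    have sub: "m *\<^sub>R (\<Sum>k\<in>A. c' k *\<^sub>R y k) = (\<Sum>k\<in>A. c k *\<^sub>R y k)" if "A \<subseteq> B" for A
      unfolding scaleR_sum_right using that \<open>m > 0\<close> by (intro sum.cong) (auto simp: c'_def)
    have ext: "(\<Sum>k\<in>F. c' k *\<^sub>R y k) = (\<Sum>k\<in>B. c' k *\<^sub>R y k)"
      using that F(1) by (intro sum.mono_neutral_right) (auto simp: c'_def)
    define S where "S = norm (\<Sum>k\<in>B. c' k *\<^sub>R y k)"
    have "norm (\<Sum>k\<in>{j}. c' k *\<^sub>R y k) \<le> S + \<zeta>"
      unfolding S_def ext[symmetric] by (rule additive) (use that j c' in auto)
    moreover have "\<bar>c' j\<bar> = 1" using j \<open>m > 0\<close> by (simp add: c'_def)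
    ultimately have "1 - \<zeta> \<le> S" using y by simp
    then have "\<epsilon> * (1 - \<zeta>) \<le> \<epsilon> * S" using \<open>\<epsilon> > 0\<close> by simp
    moreover have "\<epsilon> * (1 - \<zeta>) = \<zeta>" using \<open>\<epsilon> > 0\<close> by (simp add: \<zeta>_def field_simps)
    ultimately have "\<zeta> \<le> \<epsilon> * S" by simp
    moreover have "norm (\<Sum>k\<in>A. c' k *\<^sub>R y k) \<le> S + \<zeta>"
      unfolding S_def ext[symmetric] by (rule additive) (use that c' in auto)
    ultimately have "norm (\<Sum>k\<in>A. c' k *\<^sub>R y k) \<le> (1 + \<epsilon>) * S" by (simp add: algebra_simps)
    then have "m * norm (\<Sum>k\<in>A. c' k *\<^sub>R y k) \<le> m * ((1 + \<epsilon>) * S)"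
      using \<open>m > 0\<close> by simp
    moreover have "m * norm (\<Sum>k\<in>A. c' k *\<^sub>R y k) = norm (\<Sum>k\<in>A. c k *\<^sub>R y k)"
      using sub[OF that(1)] \<open>m > 0\<close> by (metis norm_scaleR abs_of_pos)
    moreover have "m * S = norm (\<Sum>k\<in>B. c k *\<^sub>R y k)"
      using sub[OF subset_refl] \<open>m > 0\<close> unfolding S_def by (metis norm_scaleR abs_of_pos)
    ultimately show ?thesis by (metis mult.left_commute)
  qed
  then have "suppression_unconditional_on (1 + \<epsilon>) F y"
    using y \<open>\<epsilon> > 0\<close> by (simp add: suppression_unconditional_on_def normalized_on_def)
  then show thesis using that F by blast
qed

section \<open>Suppression unconditionality under change of index set\<close>

lemma suppression_unconditional_onD:
  "suppression_unconditional_on C I e \<Longrightarrow> finite B \<Longrightarrow> A \<subseteq> B \<Longrightarrow> B \<subseteq> I \<Longrightarrow>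
    norm (\<Sum>i\<in>A. c i *\<^sub>R e i) \<le> C * norm (\<Sum>i\<in>B. c i *\<^sub>R e i)"
  by (simp add: suppression_unconditional_on_def)

lemma suppression_unconditional_on_subset:
  "suppression_unconditional_on C I e \<Longrightarrow> J \<subseteq> I \<Longrightarrow> suppression_unconditional_on C J e"
  by (auto simp: suppression_unconditional_on_def normalized_on_def)

lemma suppression_unconditional_on_reindex:
  assumes "inj_on h I" and e: "suppression_unconditional_on C (h ` I) e"
  shows "suppression_unconditional_on C I (\<lambda>i. e (h i))"
  unfolding suppression_unconditional_on_def
proof (intro conjI allI impI)
  show "C \<ge> 1" "normalized_on I (\<lambda>i. e (h i))"
    using e by (auto simp: suppression_unconditional_on_def normalized_on_def)
  fix A B and c :: "_ \<Rightarrow> real"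
  assume AB: "finite B \<and> A \<subseteq> B \<and> B \<subseteq> I"
  have sum: "(\<Sum>i\<in>G. c i *\<^sub>R e (h i)) = (\<Sum>k\<in>h ` G. c (inv_into I h k) *\<^sub>R e k)" if "G \<subseteq> I" for G
    using that inj_on_subset[OF \<open>inj_on h I\<close> that] \<open>inj_on h I\<close>
    by (subst sum.reindex) (auto intro!: sum.cong simp: inv_into_f_f subset_iff)
  have "norm (\<Sum>k\<in>h ` A. c (inv_into I h k) *\<^sub>R e k) \<le> C * norm (\<Sum>k\<in>h ` B. c (inv_into I h k) *\<^sub>R e k)"
    by (rule suppression_unconditional_onD[OF e]) (use AB in auto)
  then show "norm (\<Sum>i\<in>A. c i *\<^sub>R e (h i)) \<le> C * norm (\<Sum>i\<in>B. c i *\<^sub>R e (h i))"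
    using AB sum[of A] sum[of B] by auto
qed

lemma suppression_unconditional_on_image:
  assumes g: "inj_on g F" and e: "suppression_unconditional_on C F (\<lambda>k. e (g k))"
  shows "suppression_unconditional_on C (g ` F) e"
proof -
  have "suppression_unconditional_on C (inv_into F g ` g ` F) (\<lambda>k. e (g k))"
    using g e by (simp add: inv_into_image_cancel)
  then have *: "suppression_unconditional_on C (g ` F) (\<lambda>i. e (g (inv_into F g i)))"
    using inj_on_inv_into[of "g ` F" g F] by (rule suppression_unconditional_on_reindex[rotated]) simp
  have eq: "(\<Sum>i\<in>G. c i *\<^sub>R e (g (inv_into F g i))) = (\<Sum>i\<in>G. c i *\<^sub>R e i)" if "G \<subseteq> g ` F" for G c
    using that by (intro sum.cong) (auto simp: f_inv_into_f)
  show ?thesis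
    unfolding suppression_unconditional_on_def
  proof (intro conjI allI impI)
    show "C \<ge> 1" "normalized_on (g ` F) e"
      using e by (auto simp: suppression_unconditional_on_def normalized_on_def)
    fix A B and c :: "_ \<Rightarrow> real"
    assume AB: "finite B \<and> A \<subseteq> B \<and> B \<subseteq> g ` F"
    then have "A \<subseteq> g ` F" by blast
    with AB show "norm (\<Sum>i\<in>A. c i *\<^sub>R e i) \<le> C * norm (\<Sum>i\<in>B. c i *\<^sub>R e i)"
      using suppression_unconditional_onD[OF *, of B A c] eq[of A c] eq[of B c] by simp
  qed
qed

text \<open>Each inequality involves only a finite \<open>B\<close>, so colours of finite sets
  decide the matter. Nonempty sets suffice, which fits a partition relation that only controls sizes
  \<open>n > 0\<close>.\<close>

lemma suppression_unconditional_on_finitely: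
  assumes "C \<ge> 1"
    and "\<And>F. finite F \<Longrightarrow> F \<noteq> {} \<Longrightarrow> F \<subseteq> I \<Longrightarrow> suppression_unconditional_on C F e"
  shows "suppression_unconditional_on C I e"
  unfolding suppression_unconditional_on_def
proof (intro conjI allI impI)
  show "normalized_on I e"
    unfolding normalized_on_def
  proof
    fix i assume "i \<in> I"
    then show "norm (e i) = 1"
      using assms(2)[of "{i}"] by (simp add: suppression_unconditional_on_def normalized_on_def)
  qed
  fix A B and c :: "_ \<Rightarrow> real"
  assume AB: "finite B \<and> A \<subseteq> B \<and> B \<subseteq> I"
  show "norm (\<Sum>i\<in>A. c i *\<^sub>R e i) \<le> C * norm (\<Sum>i\<in>B. c i *\<^sub>R e i)"
  proof (cases "B = {}")
    case False
    then show ?thesis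
      using AB suppression_unconditional_onD[OF assms(2)[of B]] by simp
  qed (use AB in simp)
qed (fact assms(1))

section \<open>Choice of the subsequence\<close>

text \<open>The cardinal of \<open>K\<close> is the least well-order on \<open>K\<close>, so
  \<theta> embeds into the order that \<kappa> induces on \<open>K\<close>. The induced order may be
  longer than \<theta>, hence only an inclusion of the image in \<open>K\<close>.\<close>

lemma strictly_increasing_into_subset:
  fixes \<theta> :: "'l rel" and \<kappa> :: "'k rel"
  assumes "Card_order \<theta>" "Card_order \<kappa>" "K \<subseteq> Field \<kappa>" "|K| =o \<theta>"
  obtains \<alpha> where "strictly_increasing_into \<theta> \<kappa> \<alpha>" "inj_on \<alpha> (Field \<theta>)" "\<alpha> ` Field \<theta> \<subseteq> K"
proof -
  have wo: "Well_order \<kappa>" "Well_order \<theta>" using assms by (auto simp: card_order_on_def)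
  have Field: "Field (Restr \<kappa> K) = K" by (rule Refl_Field_Restr2) (use wo assms(3) in \<open>auto simp: order_on_defs\<close>)
  have "Well_order (Restr \<kappa> K)" by (rule Well_order_Restr[OF wo(1)])
  then have "|K| \<le>o Restr \<kappa> K" using Field card_of_least[of K "Restr \<kappa> K"] by simp
  then have "\<theta> \<le>o Restr \<kappa> K" using ordIso_ordLeq_trans[OF ordIso_symmetric[OF assms(4)]] by blast
  then obtain \<alpha> where emb: "embed \<theta> (Restr \<kappa> K) \<alpha>" unfolding ordLeq_def by blast
  have inj: "inj_on \<alpha> (Field \<theta>)" by (rule embed_inj_on[OF wo(2) emb])
  have img: "\<alpha> ` Field \<theta> \<subseteq> K" using embed_Field[OF emb] Field by simp
  have "compat \<theta> (Restr \<kappa> K) \<alpha>" by (rule embed_compat[OF emb])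
  then have "strictly_increasing_into \<theta> \<kappa> \<alpha>"
    using inj img assms(3) unfolding strictly_increasing_into_def monotone_on_def compat_def inj_on_def
    by auto
  then show thesis using that inj img by blast
qed

theorem corollary3p1:
  fixes \<epsilon> :: real
    and \<kappa> :: "'k rel"
    and \<theta> :: "'l rel"
    and x :: "'k \<Rightarrow> 'a::banach"
  assumes "\<epsilon> > 0"
    and "Cinfinite \<kappa>"
    and "Cinfinite \<theta>"
    and "partition_arrow \<kappa> \<theta> natLeq"
    and "normalized_on (Field \<kappa>) x"
    and "weakly_null_on (Field \<kappa>) x"
  shows "\<exists>\<alpha> :: 'l \<Rightarrow> 'k. strictly_increasing_into \<theta> \<kappa> \<alpha> \<and>
           suppression_unconditional_on (1 + \<epsilon>) (Field \<theta>) (\<lambda>\<sigma>. x (\<alpha> \<sigma>))"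
proof -
  define col :: "'k set \<Rightarrow> nat"
    where "col F = (if suppression_unconditional_on (1 + \<epsilon>) F x then 0 else 1)" for F
  have "col \<in> Fpow (Field \<kappa>) \<rightarrow> {0, 1}" by (simp add: col_def)
  from assms(4)[unfolded partition_arrow_def, rule_format, OF this]
  obtain K\<^sub>0 K\<^sub>1 where K: "K\<^sub>0 \<subseteq> Field \<kappa>" "K\<^sub>1 \<subseteq> Field \<kappa>" "|K\<^sub>0| =o \<theta>" "|K\<^sub>1| =o natLeq"
    and hom: "\<forall>n>0. col ` nsets K\<^sub>0 n = {0} \<or> col ` nsets K\<^sub>1 n = {1}"
    by (elim exE conjE)
  have "|UNIV :: nat set| \<le>o |K\<^sub>1|"
    using ordIso_imp_ordLeq[OF ordIso_transitive[OF card_of_nat ordIso_symmetric[OF K(4)]]] .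
  \<comment> \<open>Enumerating part of \<open>K\<^sub>1\<close> by natural numbers makes the
    results on sequences available.\<close>
  then obtain g :: "nat \<Rightarrow> 'k" where g: "inj g" "range g \<subseteq> K\<^sub>1"
    using card_of_ordLeq[of "UNIV :: nat set" K\<^sub>1] by blast
  have "normalized_on UNIV (\<lambda>k. x (g k))"
    using assms(5) g(2) K(2) by (auto simp: normalized_on_def)
  moreover have "weakly_null_on UNIV (\<lambda>k. x (g k))"
    unfolding weakly_null_on_def
  proof (intro allI impI)
    fix f :: "'a \<Rightarrow> real" and \<delta> :: real assume "bounded_linear f" "\<delta> > 0"
    then have "finite {i \<in> Field \<kappa>. \<bar>f (x i)\<bar> > \<delta>}"
      using assms(6) by (simp add: weakly_null_on_def)
    then have "finite (g -` {i \<in> Field \<kappa>. \<bar>f (x i)\<bar> > \<delta>})" using g(1) by (rule finite_vimageI)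
    then show "finite {k \<in> UNIV. \<bar>f (x (g k))\<bar> > \<delta>}"
      by (rule rev_finite_subset) (use g(2) K(2) in auto)
  qed
  ultimately have ex: "\<exists>F. finite F \<and> card F = n \<and> suppression_unconditional_on (1 + \<epsilon>) F (\<lambda>k. x (g k))" for n
    by (meson weakly_null_suppression_unconditional_nset assms(1))
  have "\<exists>F\<in>nsets K\<^sub>1 n. col F = 0" for n
  proof -
    obtain F where F: "finite F" "card F = n" "suppression_unconditional_on (1 + \<epsilon>) F (\<lambda>k. x (g k))"
      using ex by blast
    have inj: "inj_on g F" using g(1) by (rule inj_on_subset) simp
    then have "g ` F \<in> nsets K\<^sub>1 n"
      using F g(2) by (auto simp: nsets_def card_image)
    moreover have "col (g ` F) = 0"
      using suppression_unconditional_on_image[OF inj F(3)] by (simp add: col_def)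
    ultimately show ?thesis by blast
  qed
  \<comment> \<open>For every \<open>n\<close> some \<open>n\<close>-subset of
    \<open>K\<^sub>1\<close> has colour 0, so the second alternative always fails and
    \<open>K\<^sub>0\<close> is homogeneous of colour 0 in every positive size.\<close>
  then have not1: "col ` nsets K\<^sub>1 n \<noteq> {1}" for n by (metis image_eqI singletonD zero_neq_one)
  have col0: "col ` nsets K\<^sub>0 n = {0}" if "n > 0" for n using hom[rule_format, OF that] not1[of n] by simp
  have good: "suppression_unconditional_on (1 + \<epsilon>) K\<^sub>0 x"
  proof (rule suppression_unconditional_on_finitely)
    fix F assume F: "finite F" "F \<noteq> {}" "F \<subseteq> K\<^sub>0"
    then have "F \<in> nsets K\<^sub>0 (card F)" "card F > 0" by (auto simp: nsets_def card_gt_0_iff)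
    then have "col F = 0" using imageI[of F "nsets K\<^sub>0 (card F)" col] col0[of "card F"] by simp
    then show "suppression_unconditional_on (1 + \<epsilon>) F x" by (simp add: col_def split: if_splits)
  qed (use assms(1) in simp)
  obtain \<alpha> where \<alpha>: "strictly_increasing_into \<theta> \<kappa> \<alpha>" "inj_on \<alpha> (Field \<theta>)" "\<alpha> ` Field \<theta> \<subseteq> K\<^sub>0"
    by (rule strictly_increasing_into_subset[OF conjunct2[OF assms(3)] conjunct2[OF assms(2)] K(1,3)])
  have "suppression_unconditional_on (1 + \<epsilon>) (\<alpha> ` Field \<theta>) x"
    by (rule suppression_unconditional_on_subset[OF good \<alpha>(3)])
  then show ?thesis using suppression_unconditional_on_reindex[OF \<alpha>(2)] \<alpha>(1) by blast
qed

end
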